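(* The algorithm Move To Front for the server renting problem has (asymptotic) competitive ratio at most $6\mu+7$.
   Context: Server renting problem: items (jobs) arrive online. Each item has a size in $(0,1]$, an arrival time and a departure time; its length is departure time minus arrival time, and all lengths lie in $[\Delta,\mu\Delta]$ for fixed $\Delta>0$ and $\mu\ge 1$. On arrival of an item, the online algorithm learns its size but not its departure time, and must irrevocably assign it to a bin (server) of capacity $1$, either an already opened, not yet released bin or a newly opened bin, so that at every time the total size of the items currently present in each bin is at most $1$. A bin is released when all items assigned to it have departed. If an algorithm opens bins $B_1,\dots,B_m$, its cost is $\sum_i t_i$, where $t_i$ is the length of the interval between opening and release of $B_i$. $\mathrm{OPT}(\sigma)$ denotes the optimal offline cost. An online algorithm $A$ has (asymptotic) competitive ratio at most $c$ if there is a constant $b$ independent of $\sigma$ (it may depend on $\mu$ and $\Delta$) with $A(\sigma)\le c\cdot\mathrm{OPT}(\sigma)+b$ for all input sequences $\sigma$. Move To Front: the algorithm maintains a list of the open (opened and not yet released) bins; released bins are removed from the list. When a new item $x$ arrives, the bins are examined one by one starting from the front of the list until a bin with enough free space for $x$ is found, and $x$ is placed there; if no bin has enough space, a new bin is opened for $x$. After $x$ is placed in a bin, that bin is moved to the front of the list. *)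

theory Defs
  imports Complex_Main
begin

datatype item = Item (item_size: real) (arrival: real) (departure: real)

text \<open>An item occupies its server during the half-open interval from arrival (inclusive) to
  departure (exclusive): space freed at time \<open>t\<close> can be used by an item arriving at time \<open>t\<close>,
  and a bin whose last items depart at time \<open>t\<close> is already released for arrivals at time \<open>t\<close>.\<close>

definition present :: "item \<Rightarrow> real \<Rightarrow> bool" where
  "present x t \<longleftrightarrow> arrival x \<le> t \<and> t < departure x"

text \<open>Items with equal arrival times are presented in the order of the list.\<close>

definition input_seq :: "real \<Rightarrow> real \<Rightarrow> item list \<Rightarrow> bool" where
  "input_seq \<Delta> \<mu> \<sigma> \<longleftrightarrow>
     sorted (map arrival \<sigma>) \<and>
     (\<forall>x\<in>set \<sigma>. 0 < item_size x \<and> item_size x \<le> 1 \<and>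
        \<Delta> \<le> departure x - arrival x \<and> departure x - arrival x \<le> \<mu> * \<Delta>)"

text \<open>A packing of \<open>\<sigma>\<close> is a list \<open>p\<close> of bin names: item \<open>\<sigma> ! i\<close> is assigned to bin \<open>p ! i\<close>.\<close>

definition bin_items :: "nat list \<Rightarrow> nat \<Rightarrow> nat set" where
  "bin_items p b = {i. i < length p \<and> p ! i = b}"

definition load :: "item list \<Rightarrow> nat list \<Rightarrow> nat \<Rightarrow> real \<Rightarrow> real" where
  "load \<sigma> p b t = (\<Sum>i \<in> {i \<in> bin_items p b. present (\<sigma> ! i) t}. item_size (\<sigma> ! i))"

definition bin_open :: "item list \<Rightarrow> nat list \<Rightarrow> nat \<Rightarrow> real \<Rightarrow> bool" where
  "bin_open \<sigma> p b t \<longleftrightarrow> (\<exists>i \<in> bin_items p b. present (\<sigma> ! i) t)"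

text \<open>The last conjunct says that a released bin is not used again: every item goes into a bin
  which no earlier item was assigned to, or which still holds an earlier item.\<close>

definition valid_packing :: "item list \<Rightarrow> nat list \<Rightarrow> bool" where
  "valid_packing \<sigma> p \<longleftrightarrow>
     length p = length \<sigma> \<and>
     (\<forall>b t. load \<sigma> p b t \<le> 1) \<and>
     (\<forall>j < length \<sigma>. p ! j \<in> set (take j p) \<longrightarrow>
        bin_open \<sigma> (take j p) (p ! j) (arrival (\<sigma> ! j)))"

definition rental_time :: "item list \<Rightarrow> nat list \<Rightarrow> nat \<Rightarrow> real" where
  "rental_time \<sigma> p b =
     Max ((\<lambda>i. departure (\<sigma> ! i)) ` bin_items p b) - Min ((\<lambda>i. arrival (\<sigma> ! i)) ` bin_items p b)"

definition packing_cost :: "item list \<Rightarrow> nat list \<Rightarrow> real" where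
  "packing_cost \<sigma> p = (\<Sum>b \<in> set p. rental_time \<sigma> p b)"

definition OPT :: "item list \<Rightarrow> real" where
  "OPT \<sigma> = Inf {packing_cost \<sigma> p | p. valid_packing \<sigma> p}"

definition competitive_ratio_at_most ::
    "real \<Rightarrow> real \<Rightarrow> (item list \<Rightarrow> nat list) \<Rightarrow> real \<Rightarrow> bool" where
  "competitive_ratio_at_most \<Delta> \<mu> A c \<longleftrightarrow>
     (\<exists>b. \<forall>\<sigma>. input_seq \<Delta> \<mu> \<sigma> \<longrightarrow> packing_cost \<sigma> (A \<sigma>) \<le> c * OPT \<sigma> + b)"

text \<open>The arguments are the items that have already arrived, their packing, the list of bins
  (front first) after the previous arrival, and the new item. Departure times enter only through
  the question which earlier items are present when the new item arrives. A new bin is named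
  after the index of the item that opens it, so its name has not been used before.\<close>

definition mtf_step ::
    "item list \<Rightarrow> nat list \<Rightarrow> nat list \<Rightarrow> item \<Rightarrow> nat list \<times> nat list" where
  "mtf_step past p L x =
     (let L' = filter (\<lambda>b. bin_open past p b (arrival x)) L;
          b = (case find (\<lambda>b. load past p b (arrival x) + item_size x \<le> 1) L' of
                 Some b \<Rightarrow> b
               | None \<Rightarrow> length p)
      in (p @ [b], b # removeAll b L'))"

fun mtf_run :: "item list \<Rightarrow> nat list \<Rightarrow> nat list \<Rightarrow> item list \<Rightarrow> nat list" where
  "mtf_run past p L [] = p"
| "mtf_run past p L (x # xs) =
     (let (p', L') = mtf_step past p L x in mtf_run (past @ [x]) p' L' xs)"

definition move_to_front :: "item list \<Rightarrow> nat list" where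
  "move_to_front \<sigma> = mtf_run [] [] [] \<sigma>"

lemma finite_bin_items [simp]: "finite (bin_items p b)"
  unfolding bin_items_def by auto

lemma bin_items_snoc:
  "bin_items (p @ [c]) b = (if c = b then insert (length p) (bin_items p b) else bin_items p b)"
  unfolding bin_items_def by (auto simp: nth_append less_Suc_eq)

lemma load_snoc:
  assumes "length p = length past"
  shows "load (past @ [x]) (p @ [c]) b t =
    load past p b t + (if c = b \<and> present x t then item_size x else 0)"
proof -
  have nth: "(past @ [x]) ! i = past ! i" if "i \<in> bin_items p b" for i
    using that assms by (auto simp: bin_items_def nth_append)
  have nth': "(past @ [x]) ! length p = x"
    using assms by simp
  let ?S = "{i \<in> bin_items p b. present (past ! i) t}"
  have S: "{i \<in> bin_items (p @ [c]) b. present ((past @ [x]) ! i) t} =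
      (if c = b \<and> present x t then insert (length p) ?S else ?S)"
    using nth nth' by (auto simp: bin_items_snoc)
  have fin: "finite ?S" by simp
  have notin: "length p \<notin> ?S" by (auto simp: bin_items_def)
  have "(\<Sum>i\<in>?S. item_size ((past @ [x]) ! i)) = (\<Sum>i\<in>?S. item_size (past ! i))"
    by (rule sum.cong) (auto simp: nth)
  then show ?thesis
    unfolding load_def S using fin notin nth' by simp
qed

lemma load_mono_time:
  assumes "\<And>i. i < length p \<Longrightarrow> arrival (\<sigma> ! i) \<le> s" and "s \<le> t"
    and "\<And>i. i < length p \<Longrightarrow> 0 \<le> item_size (\<sigma> ! i)"
  shows "load \<sigma> p b t \<le> load \<sigma> p b s"
  unfolding load_def
  by (rule sum_mono2) (use assms in \<open>auto simp: present_def bin_items_def\<close>)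

lemma bin_open_take:
  assumes "j \<le> length p" "j \<le> length past"
  shows "bin_open (past @ ys) (take j p) b t \<longleftrightarrow> bin_open past (take j p) b t"
  using assms unfolding bin_open_def bin_items_def by (auto simp: nth_append)

lemma mtf_step_valid:
  assumes val: "valid_packing past p" and names: "\<And>b. b \<in> set p \<Longrightarrow> b < length p"
    and inp: "input_seq \<Delta> \<mu> (past @ [x])"
    and step: "mtf_step past p L x = (p', L')"
  shows "valid_packing (past @ [x]) p' \<and> (\<forall>b\<in>set p'. b < length p')"
proof -
  have len: "length p = length past" using val by (simp add: valid_packing_def)
  define t0 where "t0 = arrival x"
  let ?P = "\<lambda>b. load past p b t0 + item_size x \<le> 1"
  let ?L = "filter (\<lambda>b. bin_open past p b t0) L"
  define c where "c = (case find ?P ?L of Some b \<Rightarrow> b | None \<Rightarrow> length p)"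
  have p': "p' = p @ [c]"
    using step by (simp add: mtf_step_def Let_def c_def t0_def)
  have c: "bin_open past p c t0 \<and> ?P c \<or> c = length p"
  proof (cases "find ?P ?L")
    case None
    then show ?thesis by (simp add: c_def)
  next
    case (Some b)
    then have "?P b" "b \<in> set ?L" by (auto simp: find_Some_iff simp del: set_filter)
    then show ?thesis using Some by (simp add: c_def)
  qed
  have arr: "arrival (past ! i) \<le> t0" if "i < length p" for i
    using inp that len by (auto simp: input_seq_def sorted_append t0_def)
  have sz: "0 \<le> item_size (past ! i)" if "i < length p" for i
    using inp that len by (auto simp: input_seq_def less_imp_le)
  have szx: "item_size x \<le> 1" using inp by (auto simp: input_seq_def)
  have fresh: "bin_items p (length p) = {}"
    using names by (auto simp: bin_items_def) (metis less_irrefl nth_mem)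
  have c_load: "load past p c t0 + item_size x \<le> 1"
    using c szx fresh by (auto simp: load_def)
  have old: "load past p b t \<le> 1" for b t using val by (simp add: valid_packing_def)
  have "load (past @ [x]) p' b t \<le> 1" for b t
  proof (cases "c = b \<and> present x t")
    case True
    then have "load past p b t \<le> load past p c t0"
      using load_mono_time[of p past t0 t b] arr sz by (auto simp: present_def t0_def)
    then show ?thesis using True c_load by (simp add: p' load_snoc[OF len])
  next
    case False
    then show ?thesis using old by (auto simp: p' load_snoc[OF len])
  qed
  moreover have "bin_open (past @ [x]) (take j p') (p' ! j) (arrival ((past @ [x]) ! j))"
    if j: "j < length (past @ [x])" "p' ! j \<in> set (take j p')" for j
  proof (cases "j = length past")
    case True
    then have "c \<in> set p" using j len by (simp add: p' nth_append)
    then have "bin_open past p c t0" using c names by auto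
    then show ?thesis
      using True len bin_open_take[of "length p" p past "[x]" c t0]
      by (simp add: p' nth_append t0_def)
  next
    case False
    then show ?thesis
      using j val len bin_open_take[of j p past "[x]"]
      by (auto simp: p' nth_append valid_packing_def)
  qed
  moreover have "c \<le> length p"
    using c names by (auto simp: bin_open_def bin_items_def intro: less_imp_le)
  ultimately show ?thesis
    unfolding valid_packing_def using len names by (auto simp: p' less_Suc_eq)
qed

lemma mtf_run_valid:
  assumes "valid_packing past p" "\<And>b. b \<in> set p \<Longrightarrow> b < length p"
    and "input_seq \<Delta> \<mu> (past @ xs)"
  shows "valid_packing (past @ xs) (mtf_run past p L xs)"
  using assms
proof (induction xs arbitrary: past p L)
  case (Cons x xs)
  obtain p' L' where step: "mtf_step past p L x = (p', L')" by fastforce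
  have "input_seq \<Delta> \<mu> (past @ [x])"
    using Cons.prems(3) by (auto simp: input_seq_def sorted_append)
  note * = mtf_step_valid[OF Cons.prems(1,2) this step]
  show ?case
    using Cons.IH[of "past @ [x]" p' L'] * Cons.prems(3) step by simp
qed simp

lemma move_to_front_valid:
  assumes "input_seq \<Delta> \<mu> \<sigma>"
  shows "valid_packing \<sigma> (move_to_front \<sigma>)"
proof -
  have "valid_packing [] []"
    by (simp add: valid_packing_def load_def bin_items_def)
  from mtf_run_valid[OF this, of \<Delta> \<mu> \<sigma> "[]"] show ?thesis
    using assms by (simp add: move_to_front_def)
qed

lemma packing_cost_nonneg:
  assumes "valid_packing \<sigma> p" "\<And>x. x \<in> set \<sigma> \<Longrightarrow> arrival x \<le> departure x"
  shows "0 \<le> packing_cost \<sigma> p"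
  unfolding packing_cost_def
proof (rule sum_nonneg)
  fix b assume "b \<in> set p"
  then obtain i where i: "i \<in> bin_items p b"
    by (auto simp: bin_items_def in_set_conv_nth)
  have "Min ((\<lambda>i. arrival (\<sigma> ! i)) ` bin_items p b) \<le> arrival (\<sigma> ! i)"
    using i by simp
  also have "\<dots> \<le> departure (\<sigma> ! i)"
    using i assms by (auto simp: bin_items_def valid_packing_def)
  also have "\<dots> \<le> Max ((\<lambda>i. departure (\<sigma> ! i)) ` bin_items p b)"
    using i by simp
  finally show "0 \<le> rental_time \<sigma> p b" by (simp add: rental_time_def)
qed

lemma OPT_le_packing_cost:
  assumes "valid_packing \<sigma> p" "\<And>x. x \<in> set \<sigma> \<Longrightarrow> arrival x \<le> departure x"
  shows "OPT \<sigma> \<le> packing_cost \<sigma> p"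
  unfolding OPT_def
  by (rule cInf_lower) (use assms packing_cost_nonneg in \<open>auto intro!: bdd_belowI[of _ 0]\<close>)

end

theory Submission
  imports Defs "HOL-Analysis.Henstock_Kurzweil_Integration"
begin

text \<open>Cut the rental period of every bin at the arrivals of its items. The piece starting with the
  arrival of item \<open>i\<close> is cut again at the arrival of item \<open>i + 1\<close>: before it the bin is at the front
  of the list, after it the bin is not. Pieces of the first kind never overlap, so their total length
  is at most the time during which some item is present. If a piece of the second kind is nonempty,
  the front bin has refused item \<open>i + 1\<close>, so its load plus the size of this item exceeds 1; the length
  of the piece, at most \<open>\<mu>\<Delta>\<close>, is charged to these items in proportion to their sizes. An item of
  size \<open>s\<close> and length \<open>l\<close> is charged at most \<open>s\<mu>\<Delta>\<close> for being refused, and at most \<open>s(l + \<mu>\<Delta>)\<close> for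
  being in a bin that loses the front position, since the pieces of one bin do not overlap. As \<open>\<Delta> \<le> l\<close>,
  the charges sum to at most \<open>2\<mu> + 1\<close> times the total of all \<open>s l\<close>, which is a lower bound on
  the cost of every packing. This gives the ratio \<open>2\<mu> + 2\<close>.\<close>

section \<open>Lower bounds on the optimal cost\<close>

lemma sum_bins:
  "(\<Sum>b\<in>set p. \<Sum>i\<in>bin_items p b. f i) = (\<Sum>i<length p. f i)"
proof -
  have "(\<Sum>b\<in>set p. sum f {i \<in> {..<length p}. p ! i = b}) = sum f {..<length p}"
    by (rule sum.group) auto
  then show ?thesis by (simp add: bin_items_def)
qed

lemma has_integral_step:
  fixes l r s :: real
  assumes "A \<le> l" "l \<le> r" "r \<le> B"
  shows "((\<lambda>t. if l \<le> t \<and> t < r then s else 0) has_integral s * (r - l)) {A..B}"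
proof -
  have "((\<lambda>t. s) has_integral s * (r - l)) {l..r}"
    using has_integral_const_real[of s l r] assms by (simp add: mult.commute)
  then have "((\<lambda>t. if t \<in> {l..r} then s else 0) has_integral s * (r - l)) {A..B}"
    by (subst has_integral_restrict) (use assms in auto)
  then show ?thesis
    \<comment> \<open>The half-open and the closed interval differ only at \<open>r\<close>.\<close>
    by (rule has_integral_spike_finite[of "{r}", rotated 2]) auto
qed

lemma rental_time_bounds:
  assumes "i \<in> bin_items p b"
  shows "Min ((\<lambda>i. arrival (\<sigma> ! i)) ` bin_items p b) \<le> arrival (\<sigma> ! i)"
    and "departure (\<sigma> ! i) \<le> Max ((\<lambda>i. departure (\<sigma> ! i)) ` bin_items p b)"
  using assms by simp_all

lemma load_eq_sum:
  "load \<sigma> p b t = (\<Sum>i\<in>bin_items p b. if present (\<sigma> ! i) t then item_size (\<sigma> ! i) else 0)"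
  unfolding load_def by (simp add: sum.inter_filter)

text \<open>The load of a bin never exceeds 1, so its integral over the rental period, which is the
  volume of the items in the bin, is at most the length of that period.\<close>

lemma volume_le_packing_cost:
  assumes valid: "valid_packing \<sigma> p" and ord: "\<And>x. x \<in> set \<sigma> \<Longrightarrow> arrival x \<le> departure x"
  shows "(\<Sum>i<length \<sigma>. item_size (\<sigma> ! i) * (departure (\<sigma> ! i) - arrival (\<sigma> ! i))) \<le> packing_cost \<sigma> p"
proof -
  let ?v = "\<lambda>i. item_size (\<sigma> ! i) * (departure (\<sigma> ! i) - arrival (\<sigma> ! i))"
  have len: "length p = length \<sigma>" using valid by (simp add: valid_packing_def)
  have "(\<Sum>i\<in>bin_items p b. ?v i) \<le> rental_time \<sigma> p b" if b: "b \<in> set p" for b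
  proof -
    define A where "A = Min ((\<lambda>i. arrival (\<sigma> ! i)) ` bin_items p b)"
    define B where "B = Max ((\<lambda>i. departure (\<sigma> ! i)) ` bin_items p b)"
    have le: "A \<le> arrival (\<sigma> ! i)" "arrival (\<sigma> ! i) \<le> departure (\<sigma> ! i)" "departure (\<sigma> ! i) \<le> B"
      if "i \<in> bin_items p b" for i
      using that rental_time_bounds[OF that, of \<sigma>] ord len by (auto simp: A_def B_def bin_items_def)
    obtain i where "i \<in> bin_items p b" using b by (auto simp: bin_items_def in_set_conv_nth)
    with le have "A \<le> B" by fastforce
    have "((\<lambda>t. load \<sigma> p b t) has_integral (\<Sum>i\<in>bin_items p b. ?v i)) {A..B}"
      unfolding load_eq_sum present_def by (intro has_integral_sum has_integral_step le) auto
    moreover have "((\<lambda>t. 1) has_integral B - A) {A..B}"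
      using has_integral_const_real[of "1::real" A B] \<open>A \<le> B\<close> by simp
    ultimately have "(\<Sum>i\<in>bin_items p b. ?v i) \<le> B - A"
      by (rule has_integral_le) (use valid in \<open>simp add: valid_packing_def\<close>)
    then show ?thesis by (simp add: rental_time_def A_def B_def)
  qed
  then have "(\<Sum>b\<in>set p. \<Sum>i\<in>bin_items p b. ?v i) \<le> packing_cost \<sigma> p"
    unfolding packing_cost_def by (rule sum_mono)
  then show ?thesis by (simp add: sum_bins len)
qed

text \<open>Whenever one of the disjoint intervals is running, some item is present, so every
  packing rents at least one bin. The two counting functions are compared pointwise and then
  integrated.\<close>

lemma busy_time_le_packing_cost:
  fixes l r :: "nat \<Rightarrow> real"
  assumes valid: "valid_packing \<sigma> p" and ord: "\<And>x. x \<in> set \<sigma> \<Longrightarrow> arrival x \<le> departure x"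
    and fin: "finite S" and lr: "\<And>i. i \<in> S \<Longrightarrow> l i \<le> r i"
    and disj: "\<And>i j. i \<in> S \<Longrightarrow> j \<in> S \<Longrightarrow> i < j \<Longrightarrow> r i \<le> l j"
    and busy: "\<And>i t. i \<in> S \<Longrightarrow> l i \<le> t \<Longrightarrow> t < r i \<Longrightarrow> \<exists>x\<in>set \<sigma>. present x t"
  shows "(\<Sum>i\<in>S. r i - l i) \<le> packing_cost \<sigma> p"
proof -
  have len: "length p = length \<sigma>" using valid by (simp add: valid_packing_def)
  define A where "A = (\<lambda>b. Min ((\<lambda>i. arrival (\<sigma> ! i)) ` bin_items p b))"
  define B where "B = (\<lambda>b. Max ((\<lambda>i. departure (\<sigma> ! i)) ` bin_items p b))"
  have AB: "A b \<le> B b" if b: "b \<in> set p" for b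
  proof -
    obtain i where i: "i \<in> bin_items p b" using b by (auto simp: bin_items_def in_set_conv_nth)
    then have "arrival (\<sigma> ! i) \<le> departure (\<sigma> ! i)" using ord len by (auto simp: bin_items_def)
    with rental_time_bounds[OF i, of \<sigma>] show ?thesis by (simp add: A_def B_def)
  qed
  \<comment> \<open>\<open>D\<close> and \<open>E\<close> enclose all intervals; the inserted 0
    keeps \<open>Min\<close> and \<open>Max\<close> meaningful when \<open>S\<close> and
    \<open>set p\<close> are empty.\<close>
  define D where "D = Min (insert 0 (l ` S \<union> A ` set p))"
  define E where "E = Max (insert 0 (r ` S \<union> B ` set p))"
  have D: "i \<in> S \<Longrightarrow> D \<le> l i" "b \<in> set p \<Longrightarrow> D \<le> A b" for i b
    using fin by (auto simp: D_def intro!: Min_le)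
  have E: "i \<in> S \<Longrightarrow> r i \<le> E" "b \<in> set p \<Longrightarrow> B b \<le> E" for i b
    using fin by (auto simp: E_def intro!: Max_ge)
  let ?ind = "\<lambda>u v t. if u \<le> t \<and> t < v then 1 else (0::real)"
  have "((\<lambda>t. \<Sum>i\<in>S. ?ind (l i) (r i) t) has_integral (\<Sum>i\<in>S. 1 * (r i - l i))) {D..E}"
    using D E lr by (intro has_integral_sum fin has_integral_step) auto
  moreover have "((\<lambda>t. \<Sum>b\<in>set p. ?ind (A b) (B b) t) has_integral (\<Sum>b\<in>set p. 1 * (B b - A b))) {D..E}"
    using D E AB by (intro has_integral_sum has_integral_step) auto
  moreover have "(\<Sum>i\<in>S. ?ind (l i) (r i) t) \<le> (\<Sum>b\<in>set p. ?ind (A b) (B b) t)" for t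
  proof (cases "\<exists>i\<in>S. l i \<le> t \<and> t < r i")
    case True
    then obtain i where i: "i \<in> S" "l i \<le> t" "t < r i" by blast
    have "\<not> (l j \<le> t \<and> t < r j)" if "j \<in> S" "j \<noteq> i" for j
      using disj[of i j] disj[of j i] i that by (cases "i < j") force+
    then have "(\<Sum>i\<in>S. ?ind (l i) (r i) t) = (\<Sum>j\<in>S. if j = i then 1 else 0)"
      using i by (intro sum.cong) auto
    also have "\<dots> = 1" using fin i by simp
    finally have 1: "(\<Sum>i\<in>S. ?ind (l i) (r i) t) = 1" .
    \<comment> \<open>The bin in which \<open>p\<close> puts an item present at \<open>t\<close> is
      rented at \<open>t\<close>.\<close>
    obtain k where k: "k < length \<sigma>" "present (\<sigma> ! k) t"
      using busy[OF i] by (auto simp: in_set_conv_nth)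
    then have "k \<in> bin_items p (p ! k)" using len by (simp add: bin_items_def)
    from rental_time_bounds[OF this, of \<sigma>] k
    have "A (p ! k) \<le> t \<and> t < B (p ! k)" by (simp add: present_def A_def B_def)
    then have "1 \<le> ?ind (A (p ! k)) (B (p ! k)) t" by simp
    also have "\<dots> \<le> (\<Sum>b\<in>set p. ?ind (A b) (B b) t)"
      using k len by (intro member_le_sum) auto
    finally show ?thesis using 1 by simp
  next
    case False
    then have "(\<Sum>i\<in>S. ?ind (l i) (r i) t) = 0" by (intro sum.neutral) auto
    then show ?thesis by (simp add: sum_nonneg)
  qed
  ultimately have "(\<Sum>i\<in>S. 1 * (r i - l i)) \<le> (\<Sum>b\<in>set p. 1 * (B b - A b))"
    by (rule has_integral_le)
  then show ?thesis by (simp add: packing_cost_def rental_time_def A_def B_def)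
qed

section \<open>Packings that try the last used bin first\<close>

text \<open>Induction on the largest index \<open>m\<close>: all other intervals end by
  \<open>a m\<close>, which becomes the new \<open>hi\<close>.\<close>

lemma sum_disjoint_intervals_le:
  fixes a c :: "nat \<Rightarrow> real"
  assumes "finite S" "\<And>i j. i \<in> S \<Longrightarrow> j \<in> S \<Longrightarrow> i < j \<Longrightarrow> c i \<le> a j"
    and "\<And>i. i \<in> S \<Longrightarrow> lo \<le> a i" "\<And>i. i \<in> S \<Longrightarrow> c i \<le> hi" "lo \<le> hi"
  shows "(\<Sum>i\<in>S. c i - a i) \<le> hi - lo"
  using assms
proof (induction S arbitrary: hi rule: finite_linorder_max_induct)
  case (insert m S)
  have "(\<Sum>i\<in>S. c i - a i) \<le> a m - lo"
    by (rule insert.IH) (use insert in auto)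
  moreover have "c m \<le> hi" using insert.prems by simp
  moreover have "m \<notin> S" using insert.hyps by blast
  ultimately show ?case using insert.hyps by simp
qed simp

text \<open>This is what the analysis uses of Move To Front besides validity.
  \<open>take (Suc j) p\<close> is the packing just before item \<open>Suc j\<close> is placed, and
  \<open>p ! j\<close> is the bin used last.\<close>

definition front_refused :: "item list \<Rightarrow> nat list \<Rightarrow> bool" where
  "front_refused \<sigma> p \<longleftrightarrow> (\<forall>j. Suc j < length p \<longrightarrow> p ! Suc j \<noteq> p ! j \<longrightarrow>
      bin_open \<sigma> (take (Suc j) p) (p ! j) (arrival (\<sigma> ! Suc j)) \<longrightarrow>
      1 < load \<sigma> (take (Suc j) p) (p ! j) (arrival (\<sigma> ! Suc j)) + item_size (\<sigma> ! Suc j))"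

locale front_first_packing =
  fixes \<Delta> \<mu> :: real and \<sigma> :: "item list" and p :: "nat list"
  assumes \<Delta>_pos: "0 < \<Delta>" and \<mu>_ge_1: "1 \<le> \<mu>"
    and input: "input_seq \<Delta> \<mu> \<sigma>" and valid: "valid_packing \<sigma> p"
    and refused: "front_refused \<sigma> p"
begin

abbreviation "n \<equiv> length p"
abbreviation "arr i \<equiv> arrival (\<sigma> ! i)"
abbreviation "dep i \<equiv> departure (\<sigma> ! i)"
abbreviation "size_of i \<equiv> item_size (\<sigma> ! i)"

section \<open>Cutting rental periods into pieces\<close>

definition "later i j \<longleftrightarrow> i < j \<and> j < n \<and> p ! j = p ! i"

text \<open>The pieces from \<open>arr i\<close> to \<open>nxt i\<close>, over the items
  \<open>i\<close> of one bin, tile its rental period.\<close>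

definition "nxt i = (if \<exists>j. later i j then arr (LEAST j. later i j) else Max (dep ` bin_items p (p ! i)))"

text \<open>The cut inside the piece of \<open>i\<close>, where its bin may lose the front position.
  No arrival follows the last item, so its piece is leading throughout.\<close>

definition "lead i = (if Suc i < n then min (nxt i) (arr (Suc i)) else nxt i)"

lemma length_eq: "n = length \<sigma>"
  using valid by (simp add: valid_packing_def)

lemma arr_mono: "i \<le> j \<Longrightarrow> j < n \<Longrightarrow> arr i \<le> arr j"
  using input length_eq sorted_nth_mono[of "map arrival \<sigma>" i j] by (simp add: input_seq_def)

lemma item_bounds:
  assumes "i < n"
  shows "0 < size_of i" "\<Delta> \<le> dep i - arr i" "dep i - arr i \<le> \<mu> * \<Delta>" "arr i < dep i"
proof -
  have "\<sigma> ! i \<in> set \<sigma>" using assms length_eq by simp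
  then show "0 < size_of i" "\<Delta> \<le> dep i - arr i" "dep i - arr i \<le> \<mu> * \<Delta>"
    using input unfolding input_seq_def by blast+
  then show "arr i < dep i" using \<Delta>_pos by linarith
qed

lemma nxt_le_arr:
  assumes "later i j" shows "nxt i \<le> arr j"
proof -
  have "(LEAST j. later i j) \<le> j" using assms by (rule Least_le)
  then have "arr (LEAST j. later i j) \<le> arr j" using assms by (intro arr_mono) (auto simp: later_def)
  then show ?thesis using assms by (auto simp: nxt_def)
qed

text \<open>A bin is reused only while open, so an earlier item of the bin is present when its next
  item arrives; as the bin gets nothing in between, that item has index at most \<open>i\<close>.
  Without a next item, the item departing last has index at most \<open>i\<close>.\<close>

lemma nxt_le_dep:
  assumes "i < n" obtains x where "x \<le> i" "p ! x = p ! i" "nxt i \<le> dep x"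
proof (cases "\<exists>j. later i j")
  case True
  define j where "j = (LEAST j. later i j)"
  have j: "later i j" using True unfolding j_def by (meson LeastI_ex)
  have "i < j" "j < n" "p ! j = p ! i" using j by (auto simp: later_def)
  then have "p ! j \<in> set (take j p)" by (auto simp: in_set_conv_nth)
  then have "bin_open \<sigma> (take j p) (p ! j) (arr j)"
    using valid \<open>j < n\<close> length_eq by (simp add: valid_packing_def)
  then obtain x where x: "x < j" "x < n" "p ! x = p ! j" "arr j < dep x"
    by (auto simp: bin_open_def bin_items_def present_def)
  have "x \<le> i"
  proof (rule ccontr)
    assume "\<not> x \<le> i"
    then have "later i x" using x j by (auto simp: later_def)
    then have "j \<le> x" unfolding j_def by (rule Least_le)
    then show False using x by simp
  qed
  moreover have "nxt i = arr j" using True by (simp add: nxt_def j_def)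
  ultimately show thesis using that[of x] x \<open>p ! j = p ! i\<close> by simp
next
  case False
  have "dep ` bin_items p (p ! i) \<noteq> {}" using assms by (auto simp: bin_items_def)
  then have "Max (dep ` bin_items p (p ! i)) \<in> dep ` bin_items p (p ! i)" by (intro Max_in) auto
  then obtain x where x: "x \<in> bin_items p (p ! i)" "nxt i = dep x" using False by (auto simp: nxt_def)
  then have "x \<le> i" using False by (auto simp: later_def bin_items_def not_less[symmetric])
  then show thesis using that[of x] x by (simp add: bin_items_def)
qed

lemma arr_le_nxt:
  assumes "i < n" shows "arr i \<le> nxt i"
proof (cases "\<exists>j. later i j")
  case True
  define j where "j = (LEAST j. later i j)"
  have "later i j" using True unfolding j_def by (meson LeastI_ex)
  then have "arr i \<le> arr j" using arr_mono by (simp add: later_def)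
  then show ?thesis using True by (simp add: nxt_def j_def)
next
  case False
  have "dep i \<le> Max (dep ` bin_items p (p ! i))" using assms by (auto simp: bin_items_def)
  then show ?thesis using False item_bounds(4)[OF assms] by (simp add: nxt_def)
qed

text \<open>The item from \<open>nxt_le_dep\<close> arrives no later than \<open>i\<close> and stays
  at most \<open>\<mu> * \<Delta>\<close>.\<close>

lemma nxt_le: assumes "i < n" shows "nxt i \<le> arr i + \<mu> * \<Delta>"
proof -
  obtain x where x: "x \<le> i" "p ! x = p ! i" "nxt i \<le> dep x" using nxt_le_dep[OF assms] .
  then show ?thesis using arr_mono[of x i] item_bounds(3)[of x] assms by simp
qed

text \<open>The sum telescopes; the induction passes from \<open>i\<close> to the next item of its
  bin.\<close>

lemma sum_nxt_from:
  "i < n \<Longrightarrow> Max (dep ` bin_items p (p ! i)) - arr i =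
    (\<Sum>k\<in>{k \<in> bin_items p (p ! i). i \<le> k}. nxt k - arr k)"
proof (induction "n - i" arbitrary: i rule: less_induct)
  case less
  show ?case
  proof (cases "\<exists>j. later i j")
    case True
    define j where "j = (LEAST j. later i j)"
    have "later i j" using True unfolding j_def by (meson LeastI_ex)
    then have j: "i < j" "j < n" "p ! j = p ! i" by (auto simp: later_def)
    have "j \<le> k" if "k \<in> bin_items p (p ! i)" "i \<le> k" "k \<noteq> i" for k
      unfolding j_def using that by (intro Least_le) (auto simp: later_def bin_items_def)
    then have "{k \<in> bin_items p (p ! i). i \<le> k} = insert i {k \<in> bin_items p (p ! j). j \<le> k}"
      using j less.prems by (fastforce simp: bin_items_def)
    moreover have "nxt i = arr j" using True by (simp add: nxt_def j_def)
    moreover have "n - j < n - i" using j by simp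
    ultimately show ?thesis using less.hyps[of j] j by simp
  next
    case False
    have "{k \<in> bin_items p (p ! i). i \<le> k} = {i}"
      using False less.prems by (auto simp: bin_items_def later_def order_le_less)
    then show ?thesis using False by (simp add: nxt_def)
  qed
qed

lemma rental_time_eq:
  assumes "b \<in> set p"
  shows "rental_time \<sigma> p b = (\<Sum>i\<in>bin_items p b. nxt i - arr i)"
proof -
  define f where "f = Min (bin_items p b)"
  have ne: "bin_items p b \<noteq> {}" using assms by (auto simp: bin_items_def in_set_conv_nth)
  then have "f \<in> bin_items p b" unfolding f_def by (intro Min_in) auto
  then have f: "f < n" "p ! f = b" by (auto simp: bin_items_def)
  have fle: "f \<le> k" if "k \<in> bin_items p b" for k using that by (simp add: f_def)
  have "Min (arr ` bin_items p b) = arr f"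
    by (rule Min_eqI) (use fle \<open>f \<in> bin_items p b\<close> in \<open>auto simp: bin_items_def intro!: arr_mono\<close>)
  moreover have "{k \<in> bin_items p b. f \<le> k} = bin_items p b" using fle by auto
  ultimately show ?thesis using sum_nxt_from[OF f(1)] f by (simp add: rental_time_def)
qed

lemma packing_cost_eq: "packing_cost \<sigma> p = (\<Sum>i<n. nxt i - arr i)"
proof -
  have "packing_cost \<sigma> p = (\<Sum>b\<in>set p. \<Sum>i\<in>bin_items p b. nxt i - arr i)"
    unfolding packing_cost_def by (rule sum.cong) (simp_all add: rental_time_eq)
  then show ?thesis by (simp only: sum_bins)
qed

lemma lead_bounds:
  assumes "i < n" shows "arr i \<le> lead i" "lead i \<le> nxt i"
  using arr_le_nxt[OF assms] arr_mono[of i "Suc i"] by (auto simp: lead_def)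

text \<open>Leading pieces end by the next arrival, hence are disjoint, and the item from
  \<open>nxt_le_dep\<close> is present throughout the piece of \<open>i\<close>.\<close>

lemma leading_time_le_packing_cost:
  assumes "valid_packing \<sigma> q"
  shows "(\<Sum>i<n. lead i - arr i) \<le> packing_cost \<sigma> q"
proof (rule busy_time_le_packing_cost[OF assms])
  fix x assume "x \<in> set \<sigma>"
  then show "arrival x \<le> departure x"
    using item_bounds(4) length_eq by (metis in_set_conv_nth less_imp_le)
next
  fix i j :: nat assume ij: "i \<in> {..<n}" "j \<in> {..<n}" "i < j"
  then have "lead i \<le> arr (Suc i)" by (simp add: lead_def)
  also have "\<dots> \<le> arr j" using ij by (intro arr_mono) auto
  finally show "lead i \<le> arr j" .
next
  fix i :: nat and t assume i: "i \<in> {..<n}" "arr i \<le> t" "t < lead i"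
  then obtain x where x: "x \<le> i" "nxt i \<le> dep x" using nxt_le_dep by blast
  then have "present (\<sigma> ! x) t"
    using i lead_bounds(2)[of i] arr_mono[of x i] by (simp add: present_def)
  moreover have "\<sigma> ! x \<in> set \<sigma>" using x i length_eq by simp
  ultimately show "\<exists>x\<in>set \<sigma>. present x t" by blast
qed (use lead_bounds in auto)

section \<open>Charging the trailing time to item sizes\<close>

definition "charged i = {x. x \<le> i \<and> p ! x = p ! i \<and> present (\<sigma> ! x) (arr (Suc i))}"

text \<open>The refusal inequality is multiplied by the length of the trailing piece. That length is
  kept exact for the charged items, since it is summed over disjoint pieces later, and estimated by
  \<open>\<mu> * \<Delta>\<close> for the refused item.\<close>

lemma trailing_time_le:
  assumes i: "Suc i < n"
  shows "nxt i - lead i \<le> (\<Sum>x\<in>charged i. size_of x * (nxt i - lead i)) + size_of (Suc i) * (\<mu> * \<Delta>)"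
proof (cases "lead i < nxt i")
  case False
  then have "nxt i = lead i" using lead_bounds[of i] i by simp
  then show ?thesis using item_bounds(1)[of "Suc i"] \<Delta>_pos \<mu>_ge_1 i by simp
next
  case True
  \<comment> \<open>A nonempty trailing piece means that the bin outlasts the arrival of
    \<open>Suc i\<close> without receiving that item.\<close>
  then have gt: "arr (Suc i) < nxt i" using i by (auto simp: lead_def min_def split: if_splits)
  have "\<not> later i (Suc i)" using nxt_le_arr gt by fastforce
  then have other: "p ! Suc i \<noteq> p ! i" using i by (simp add: later_def)
  have eq: "{k \<in> bin_items (take (Suc i) p) (p ! i). present (\<sigma> ! k) (arr (Suc i))} = charged i"
    using i by (auto simp: bin_items_def charged_def)
  obtain x where x: "x \<le> i" "p ! x = p ! i" "nxt i \<le> dep x" using nxt_le_dep[of i] i by auto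
  then have "x \<in> charged i" using gt arr_mono[of x "Suc i"] i by (simp add: charged_def present_def)
  then have "bin_open \<sigma> (take (Suc i) p) (p ! i) (arr (Suc i))"
    using eq unfolding bin_open_def by blast
  with refused i other
  have "1 < load \<sigma> (take (Suc i) p) (p ! i) (arr (Suc i)) + size_of (Suc i)"
    by (simp add: front_refused_def)
  then have 1: "1 < (\<Sum>x\<in>charged i. size_of x) + size_of (Suc i)"
    by (simp only: load_def eq)
  have "nxt i - lead i \<le> ((\<Sum>x\<in>charged i. size_of x) + size_of (Suc i)) * (nxt i - lead i)"
    using mult_right_mono[OF less_imp_le[OF 1], of "nxt i - lead i"] True by simp
  also have "\<dots> = (\<Sum>x\<in>charged i. size_of x * (nxt i - lead i)) + size_of (Suc i) * (nxt i - lead i)"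
    by (simp add: distrib_right sum_distrib_right)
  finally have "nxt i - lead i \<le> \<dots>" .
  moreover have "size_of (Suc i) * (nxt i - lead i) \<le> size_of (Suc i) * (\<mu> * \<Delta>)"
    using nxt_le[of i] lead_bounds[of i] item_bounds(1)[of "Suc i"] i by (intro mult_left_mono) auto
  ultimately show ?thesis by simp
qed

text \<open>The pieces charging \<open>x\<close> all belong to the bin of \<open>x\<close>, so they
  are disjoint. They start no earlier than \<open>arr x\<close>, and they start before
  \<open>dep x\<close>, hence end by \<open>dep x + \<mu> * \<Delta>\<close>.\<close>

lemma trailing_time_while_charged:
  assumes x: "x < n"
  shows "(\<Sum>i\<in>{i. Suc i < n \<and> x \<in> charged i}. nxt i - lead i) \<le> dep x - arr x + \<mu> * \<Delta>"
proof -
  let ?I = "{i. Suc i < n \<and> x \<in> charged i}"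
  have "(\<Sum>i\<in>?I. nxt i - lead i) \<le> (\<Sum>i\<in>?I. nxt i - arr i)"
    using lead_bounds by (intro sum_mono) auto
  also have "\<dots> \<le> (dep x + \<mu> * \<Delta>) - arr x"
  proof (rule sum_disjoint_intervals_le)
    show "finite ?I" by (rule finite_subset[of _ "{..<n}"]) auto
    show "nxt i \<le> arr j" if "i \<in> ?I" "j \<in> ?I" "i < j" for i j
      using that by (intro nxt_le_arr) (auto simp: later_def charged_def)
    show "arr x \<le> arr i" if "i \<in> ?I" for i
      using that by (auto simp: charged_def intro: arr_mono)
    show "nxt i \<le> dep x + \<mu> * \<Delta>" if "i \<in> ?I" for i
      using that nxt_le[of i] arr_mono[of i "Suc i"] by (auto simp: charged_def present_def)
    show "arr x \<le> dep x + \<mu> * \<Delta>"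
      using item_bounds(2-4)[OF x] \<Delta>_pos by simp
  qed
  finally show ?thesis by simp
qed

text \<open>Per unit of its volume an item pays at most \<open>\<mu>\<close> as the refused item,
  which happens at most once, and \<open>1 + \<mu>\<close> as a charged item.\<close>

lemma trailing_time_le_volume:
  "(\<Sum>i<n. nxt i - lead i) \<le> (2 * \<mu> + 1) * (\<Sum>i<n. size_of i * (dep i - arr i))"
proof -
  let ?J = "{i. Suc i < n}"
  have finJ: "finite ?J" by (rule finite_subset[of _ "{..<n}"]) auto
  \<comment> \<open>Each length is at least \<open>\<Delta>\<close>, so
    \<open>\<mu> * \<Delta>\<close> can be paid by the length of any single item.\<close>
  have \<mu>\<Delta>: "\<mu> * \<Delta> \<le> \<mu> * (dep x - arr x)" if "x < n" for x
    using item_bounds(2)[OF that] \<mu>_ge_1 by (intro mult_left_mono) auto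
  have "(\<Sum>i\<in>?J. size_of (Suc i) * (\<mu> * \<Delta>)) = (\<Sum>i\<in>Suc ` ?J. size_of i * (\<mu> * \<Delta>))"
    by (simp add: sum.reindex)
  also have "\<dots> \<le> (\<Sum>i<n. size_of i * (\<mu> * \<Delta>))"
  proof (rule sum_mono2)
    fix i assume "i \<in> {..<n} - Suc ` ?J"
    then show "0 \<le> size_of i * (\<mu> * \<Delta>)"
      using item_bounds(1)[of i] \<mu>_ge_1 \<Delta>_pos by simp
  qed auto
  also have "\<dots> \<le> (\<Sum>i<n. size_of i * (\<mu> * (dep i - arr i)))"
    using item_bounds(1) \<mu>\<Delta> by (intro sum_mono mult_left_mono[of "\<mu> * \<Delta>"]) (auto intro: less_imp_le)
  finally have refusing: "(\<Sum>i\<in>?J. size_of (Suc i) * (\<mu> * \<Delta>)) \<le> \<dots>" .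

  \<comment> \<open>Double counting: the charges are regrouped by the item that pays them.\<close>
  have "(\<Sum>i\<in>?J. \<Sum>x\<in>charged i. size_of x * (nxt i - lead i)) =
      (\<Sum>i\<in>?J. \<Sum>x | x \<in> {..<n} \<and> x \<in> charged i. size_of x * (nxt i - lead i))"
    by (intro sum.cong) (auto simp: charged_def)
  also have "\<dots> = (\<Sum>x<n. \<Sum>i | i \<in> ?J \<and> x \<in> charged i. size_of x * (nxt i - lead i))"
    by (rule sum.swap_restrict) (use finJ in auto)
  also have "\<dots> = (\<Sum>x<n. size_of x * (\<Sum>i\<in>{i. Suc i < n \<and> x \<in> charged i}. nxt i - lead i))"
    by (simp add: sum_distrib_left)
  also have "\<dots> \<le> (\<Sum>x<n. size_of x * ((1 + \<mu>) * (dep x - arr x)))"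
  proof (intro sum_mono mult_left_mono)
    fix x assume "x \<in> {..<n}"
    then have x: "x < n" by simp
    show "0 \<le> size_of x" using item_bounds(1)[OF x] by simp
    show "(\<Sum>i\<in>{i. Suc i < n \<and> x \<in> charged i}. nxt i - lead i) \<le> (1 + \<mu>) * (dep x - arr x)"
      using trailing_time_while_charged[OF x] \<mu>\<Delta>[OF x] by (simp add: algebra_simps)
  qed
  finally have inside: "(\<Sum>i\<in>?J. \<Sum>x\<in>charged i. size_of x * (nxt i - lead i)) \<le> \<dots>" .

  have "(\<Sum>i<n. nxt i - lead i) = (\<Sum>i\<in>?J. nxt i - lead i)"
    by (rule sum.mono_neutral_right) (auto simp: lead_def)
  also have "\<dots> \<le> (\<Sum>i\<in>?J. (\<Sum>x\<in>charged i. size_of x * (nxt i - lead i)) + size_of (Suc i) * (\<mu> * \<Delta>))"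
    using trailing_time_le by (intro sum_mono) auto
  also have "\<dots> = (\<Sum>i\<in>?J. \<Sum>x\<in>charged i. size_of x * (nxt i - lead i)) + (\<Sum>i\<in>?J. size_of (Suc i) * (\<mu> * \<Delta>))"
    by (rule sum.distrib)
  also have "\<dots> \<le> (\<Sum>x<n. size_of x * ((1 + \<mu>) * (dep x - arr x))) + (\<Sum>i<n. size_of i * (\<mu> * (dep i - arr i)))"
    by (rule add_mono[OF inside refusing])
  also have "\<dots> = (2 * \<mu> + 1) * (\<Sum>i<n. size_of i * (dep i - arr i))"
    unfolding sum_distrib_left sum.distrib[symmetric] by (intro sum.cong) (auto simp: algebra_simps)
  finally show ?thesis .
qed

lemma packing_cost_le_OPT: "packing_cost \<sigma> p \<le> (2 * \<mu> + 2) * OPT \<sigma>"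
proof -
  have ord: "arrival x \<le> departure x" if "x \<in> set \<sigma>" for x
    using that item_bounds(4) length_eq by (metis in_set_conv_nth less_imp_le)
  \<comment> \<open>A bound for every packing passes to the infimum, taken over a nonempty set
    because \<open>p\<close> is valid.\<close>
  have OPT_ge: "c \<le> OPT \<sigma>" if "\<And>q. valid_packing \<sigma> q \<Longrightarrow> c \<le> packing_cost \<sigma> q" for c
    unfolding OPT_def by (rule cInf_greatest) (use valid that in auto)
  have "packing_cost \<sigma> p = (\<Sum>i<n. lead i - arr i) + (\<Sum>i<n. nxt i - lead i)"
    by (simp add: packing_cost_eq flip: sum.distrib)
  moreover have "(\<Sum>i<n. lead i - arr i) \<le> OPT \<sigma>"
    by (rule OPT_ge) (rule leading_time_le_packing_cost)
  moreover have "(\<Sum>i<n. nxt i - lead i) \<le> (2 * \<mu> + 1) * OPT \<sigma>"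
  proof (rule order_trans[OF trailing_time_le_volume mult_left_mono])
    show "(\<Sum>i<n. size_of i * (dep i - arr i)) \<le> OPT \<sigma>"
      by (rule OPT_ge) (use volume_le_packing_cost ord length_eq in simp)
  qed (use \<mu>_ge_1 in simp)
  ultimately show ?thesis by (simp add: algebra_simps)
qed

end

section \<open>Move To Front tries the last used bin first\<close>

lemma load_append:
  assumes "length p \<le> length past"
  shows "load (past @ ys) p b t = load past p b t"
  unfolding load_def using assms
  by (intro sum.cong) (auto simp: bin_items_def nth_append)

text \<open>The invariant is that the list starts with the bin used last. If this bin is open, it
  survives the filter in first place and is examined first, so another choice means that the item
  did not fit.\<close>

lemma mtf_step_front:
  assumes len: "length p = length past" and front: "p \<noteq> [] \<longrightarrow> L \<noteq> [] \<and> hd L = last p"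
    and ref: "front_refused past p" and step: "mtf_step past p L x = (p', L')"
  shows "length p' = length (past @ [x])" "p' \<noteq> [] \<longrightarrow> L' \<noteq> [] \<and> hd L' = last p'"
    "front_refused (past @ [x]) p'"
proof -
  define t where "t = arrival x"
  let ?P = "\<lambda>b. load past p b t + item_size x \<le> 1"
  let ?F = "filter (\<lambda>b. bin_open past p b t) L"
  define c where "c = (case find ?P ?F of Some b \<Rightarrow> b | None \<Rightarrow> length p)"
  have p': "p' = p @ [c]" and L': "L' = c # removeAll c ?F"
    using step by (simp_all add: mtf_step_def Let_def c_def t_def)
  show "length p' = length (past @ [x])" using len p' by simp
  show "p' \<noteq> [] \<longrightarrow> L' \<noteq> [] \<and> hd L' = last p'" using p' L' by simp
  have new: "\<not> ?P (last p)" if ne: "p \<noteq> []" and op: "bin_open past p (last p) t" and "c \<noteq> last p"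
  proof
    assume P: "?P (last p)"
    obtain Ls where "L = last p # Ls" using front ne by (cases L) auto
    then have "find ?P ?F = Some (last p)" using op P by simp
    then show False using that by (simp add: c_def)
  qed
  show "front_refused (past @ [x]) p'"
    unfolding front_refused_def
  proof (intro allI impI)
    fix j
    assume j: "Suc j < length p'" and ne: "p' ! Suc j \<noteq> p' ! j"
      and op: "bin_open (past @ [x]) (take (Suc j) p') (p' ! j) (arrival ((past @ [x]) ! Suc j))"
    have le: "Suc j \<le> length p" using j p' by simp
    have take: "take (Suc j) p' = take (Suc j) p" and nth: "p' ! j = p ! j"
      using le p' by (auto simp: nth_append)
    note op' = op[unfolded take nth bin_open_take[OF le le[unfolded len]]]
    show "1 < load (past @ [x]) (take (Suc j) p') (p' ! j) (arrival ((past @ [x]) ! Suc j))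
        + item_size ((past @ [x]) ! Suc j)"
    \<comment> \<open>Only the last old item meets the new one; for smaller \<open>j\<close> the
      claim is inherited from \<open>past\<close>.\<close>
    proof (cases "Suc j = length p")
      case True
      then have "p \<noteq> []" and "j = length p - 1" by auto
      then have last: "p ! j = last p" by (simp add: last_conv_nth)
      have "bin_open past p (last p) t" using op' True len last by (simp add: t_def)
      moreover have "c \<noteq> last p" using ne nth True last p' by (metis nth_append_length)
      ultimately have "1 < load past p (last p) t + item_size x" using new \<open>p \<noteq> []\<close> by simp
      moreover have "take (Suc j) p = p" using True by simp
      ultimately show ?thesis
        unfolding take nth last using True len by (simp add: load_append t_def)
    next
      case False
      then have lt: "Suc j < length p" using le by simp
      then have "p ! Suc j \<noteq> p ! j" using ne p' by (simp add: nth_append)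
      then show ?thesis
        using ref lt op' len by (simp add: front_refused_def take nth load_append nth_append)
    qed
  qed
qed

lemma mtf_run_front_refused:
  assumes "length p = length past" "p \<noteq> [] \<longrightarrow> L \<noteq> [] \<and> hd L = last p" "front_refused past p"
  shows "front_refused (past @ xs) (mtf_run past p L xs)"
  using assms
proof (induction xs arbitrary: past p L)
  case (Cons x xs)
  obtain p' L' where step: "mtf_step past p L x = (p', L')" by fastforce
  show ?case
    using Cons.IH[OF mtf_step_front[OF Cons.prems step]] step by simp
qed simp

lemma move_to_front_refused: "front_refused \<sigma> (move_to_front \<sigma>)"
  using mtf_run_front_refused[of "[]" "[]" "[]" \<sigma>]
  by (simp add: move_to_front_def front_refused_def)

theorem theorem4:
  fixes \<Delta> \<mu> :: real
  assumes "\<Delta> > 0" and "\<mu> \<ge> 1"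
  shows "competitive_ratio_at_most \<Delta> \<mu> move_to_front (6 * \<mu> + 7)"
  unfolding competitive_ratio_at_most_def
proof (intro exI allI impI)
  fix \<sigma> assume inp: "input_seq \<Delta> \<mu> \<sigma>"
  interpret front_first_packing \<Delta> \<mu> \<sigma> "move_to_front \<sigma>"
    by unfold_locales (use assms inp move_to_front_valid[OF inp] move_to_front_refused in auto)
  \<comment> \<open>Raising the factor from \<open>2 * \<mu> + 2\<close> to
    \<open>6 * \<mu> + 7\<close> requires \<open>OPT \<sigma>\<close> to be nonnegative, which
    follows from the proved bound as the cost is nonnegative.\<close>
  have "0 \<le> packing_cost \<sigma> (move_to_front \<sigma>)"
    unfolding packing_cost_eq by (intro sum_nonneg) (use arr_le_nxt in auto)
  with packing_cost_le_OPT have "0 \<le> (2 * \<mu> + 2) * OPT \<sigma>" by linarith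
  then have "0 \<le> OPT \<sigma>" using assms by (simp add: zero_le_mult_iff)
  then have "(2 * \<mu> + 2) * OPT \<sigma> \<le> (6 * \<mu> + 7) * OPT \<sigma>"
    using assms by (intro mult_right_mono) auto
  then show "packing_cost \<sigma> (move_to_front \<sigma>) \<le> (6 * \<mu> + 7) * OPT \<sigma> + 0"
    using packing_cost_le_OPT by linarith
qed

end
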